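(* For every positive integer $h$, the edge-forwarding index of the multiplicative circulant graph $\Gamma_{2^h}=MC(2^h)$ satisfies $$\frac{(3h+1)2^{h+1}-2(-1)^h}{18h-9}\leq \pi(\Gamma_{2^h})\leq \frac{9\cdot 2^h+(3h+1)2^h-(-1)^h-36h+27}{9}.$$
   Context: For integers $m>1$, $h>0$, $MC(m^h)$ is the graph with vertex set $\mathbb{Z}_{m^h}$ in which distinct vertices $x,y$ are adjacent iff $x-y\equiv \pm m^i \pmod{m^h}$ for some $i\in\{0,\ldots,h-1\}$. For a connected graph $\Gamma$ on $N$ vertices, a routing $R$ is a choice of one path $R(x,y)$ from $x$ to $y$ for each of the $N(N-1)$ ordered pairs $(x,y)$ of distinct vertices. The load $\pi_e(\Gamma,R)$ of an edge $e$ is the number of paths of $R$ passing through $e$; $\pi(\Gamma,R)=\max_e \pi_e(\Gamma,R)$; and the edge-forwarding index is $\pi(\Gamma)=\min_R \pi(\Gamma,R)$ over all routings $R$ of $\Gamma$. *)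

theory Defs
  imports Complex_Main "HOL-Number_Theory.Cong"
begin

text \<open>A simple graph is a pair of a vertex set and a set of undirected edges, an edge being the
two-element set of its endpoints.\<close>

type_synonym 'a ugraph = "'a set \<times> 'a set set"

abbreviation uverts :: "'a ugraph \<Rightarrow> 'a set" where
  "uverts G \<equiv> fst G"

abbreviation uedges :: "'a ugraph \<Rightarrow> 'a set set" where
  "uedges G \<equiv> snd G"

definition path_edges :: "'a list \<Rightarrow> 'a set set" where
  "path_edges p = {{p ! i, p ! Suc i} | i. Suc i < length p}"

text \<open>A path is given by its list of vertices, which are pairwise distinct.\<close>

definition is_path :: "'a ugraph \<Rightarrow> 'a \<Rightarrow> 'a list \<Rightarrow> 'a \<Rightarrow> bool" where
  "is_path G x p y \<longleftrightarrow>
     p \<noteq> [] \<and> hd p = x \<and> last p = y \<and> distinct p \<and>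
     set p \<subseteq> uverts G \<and> path_edges p \<subseteq> uedges G"

text \<open>The value of a routing on the diagonal is irrelevant: only ordered pairs of distinct
vertices are constrained and counted.\<close>

definition is_routing :: "'a ugraph \<Rightarrow> ('a \<Rightarrow> 'a \<Rightarrow> 'a list) \<Rightarrow> bool" where
  "is_routing G R \<longleftrightarrow>
     (\<forall>x \<in> uverts G. \<forall>y \<in> uverts G. x \<noteq> y \<longrightarrow> is_path G x (R x y) y)"

definition edge_load :: "'a ugraph \<Rightarrow> ('a \<Rightarrow> 'a \<Rightarrow> 'a list) \<Rightarrow> 'a set \<Rightarrow> nat" where
  "edge_load G R e =
     card {(x, y). x \<in> uverts G \<and> y \<in> uverts G \<and> x \<noteq> y \<and> e \<in> path_edges (R x y)}"

definition max_edge_load :: "'a ugraph \<Rightarrow> ('a \<Rightarrow> 'a \<Rightarrow> 'a list) \<Rightarrow> nat" where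
  "max_edge_load G R = Max (edge_load G R ` uedges G)"

text \<open>Meaningful for finite connected graphs with at least one edge; only then do a routing and
a maximum over the edges exist.\<close>

definition edge_forwarding_index :: "'a ugraph \<Rightarrow> nat" where
  "edge_forwarding_index G = (LEAST k. \<exists>R. is_routing G R \<and> max_edge_load G R = k)"

text \<open>The residues modulo \<open>m ^ h\<close> are represented by the integers from \<open>0\<close> to \<open>m ^ h - 1\<close>.\<close>

definition MC :: "nat \<Rightarrow> nat \<Rightarrow> int ugraph" where
  "MC m h =
     (let V = {0..<int m ^ h} in
      (V, {{x, y} | x y. x \<in> V \<and> y \<in> V \<and> x \<noteq> y \<and>
            (\<exists>i<h. [x - y = int m ^ i] (mod int m ^ h) \<or>
                   [x - y = - (int m ^ i)] (mod int m ^ h))}))"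

end

theory Submission
  imports Defs
begin

text \<open>
  Lower bound: a path from \<open>x\<close> to \<open>y\<close> writes \<open>y - x\<close> as a signed sum of powers of two modulo
  \<open>2 ^ h\<close>, so it has at least as many edges as the non-adjacent form of \<open>y - x\<close> has nonzero digits.
  The total digit count \<open>S h\<close> over all residues satisfies
  \<open>S (h + 2) = S (h + 1) + 2 ^ (h + 1) + 2 * S h\<close>; averaging the total load \<open>2 ^ h * S h\<close> over the
  at most \<open>(2 * h - 1) * 2 ^ (h - 1)\<close> edges gives the bound.

  Upper bound: route from \<open>x\<close> to \<open>y\<close> by adding the powers of two in the ordinary binary expansion
  of \<open>(y - x) mod 2 ^ h\<close>. Such paths need not be shortest, but each orientation of an edge is used
  by at most \<open>2 ^ (h - 1)\<close> of them, so every load is at most \<open>2 ^ h\<close>. This suffices except for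
  \<open>h = 2\<close>, where the graph is complete and the direct routing has load 2.
\<close>

section \<open>Weight of the non-adjacent form modulo a power of two\<close>

text \<open>For odd \<open>d\<close>, exactly one of \<open>d - 1\<close> and \<open>d + 1\<close> is divisible by 4, and \<open>(d + 1) div 4\<close> is a
  quarter of that one: the digit is chosen so that the next digit vanishes.\<close>

fun naf_weight :: "nat \<Rightarrow> int \<Rightarrow> nat" where
  "naf_weight 0 d = 0"
| "naf_weight (Suc 0) d = (if even d then 0 else 1)"
| "naf_weight (Suc (Suc h)) d =
     (if even d then naf_weight (Suc h) (d div 2) else Suc (naf_weight h ((d + 1) div 4)))"

lemma naf_weight_double: "naf_weight (Suc h) (2 * d) = naf_weight h d"
  by (cases h) auto

lemma naf_weight_zero [simp]: "naf_weight h 0 = 0"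
  by (induction h "0::int" rule: naf_weight.induct) auto

text \<open>Adding a multiple of \<open>2 ^ (h + 2)\<close> to an odd \<open>d\<close> moves
  \<open>(d + 1) div 4\<close> by the same multiple of \<open>2 ^ h\<close>, so periodicity passes
  down the recursion. Hence the weight is a function on residues.\<close>

lemma naf_weight_periodic: "naf_weight h (d + 2 ^ h * q) = naf_weight h d"
proof (induction h d arbitrary: q rule: naf_weight.induct)
  case (3 h d)
  show ?case
  proof (cases "even d")
    case True
    then obtain e where "d = 2 * e" by blast
    with 3(1)[OF True, of q] show ?thesis
      by (simp add: algebra_simps)
  next
    case False
    have "(d + 2 ^ Suc (Suc h) * q + 1) div 4 = (d + 1) div 4 + 2 ^ h * q"
      by (simp add: algebra_simps)
    with 3(2)[OF False, of q] False show ?thesis by simp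
  qed
qed auto

lemma naf_weight_mod: "naf_weight h (d mod 2 ^ h) = naf_weight h d"
  using naf_weight_periodic[of h "d mod 2 ^ h" "d div 2 ^ h"] by simp

lemma naf_weight_cong:
  "[d = e] (mod 2 ^ h) \<Longrightarrow> naf_weight h d = naf_weight h e"
  by (metis naf_weight_mod cong_def)

text \<open>This Lipschitz property is the heart of the lower bound. Passing to
  \<open>d div 2\<close> or \<open>(d + 1) div 4\<close> turns the added power into a smaller one,
  or into 0 or 1 when 2 is added to an odd \<open>d\<close>. Only adding 1 changes the parity; it
  needs the comparisons \<open>near\<close> and \<open>near'\<close>.\<close>

lemma naf_weight_step:
  "\<bar>int (naf_weight h (d + 2 ^ i)) - int (naf_weight h d)\<bar> \<le> 1"
proof (induction h arbitrary: d i rule: less_induct)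
  case (less h)
  consider "h = 0" | "h = 1" | k where "h = Suc (Suc k)"
    by (metis One_nat_def not0_implies_Suc)
  then show ?case
  proof cases
    case (3 k)
    have IHS: "\<bar>int (naf_weight (Suc k) (e + 2 ^ j)) - int (naf_weight (Suc k) e)\<bar> \<le> 1" for e j
      using less[of "Suc k"] 3 by simp
    have IH: "\<bar>int (naf_weight k (e + 2 ^ j)) - int (naf_weight k e)\<bar> \<le> 1" for e j
      using less[of k] 3 by simp
    note dbl = naf_weight_double[of k]
    \<comment> \<open>The even one of \<open>e\<close> and \<open>e + 1\<close> is twice
      \<open>(e + 1) div 2\<close>, so its weight is that of \<open>(e + 1) div 2\<close> at length
      \<open>k\<close>. The odd one is one unit step away.\<close>
    have near: "naf_weight (Suc k) e \<le> Suc (naf_weight k ((e + 1) div 2))"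
        "naf_weight (Suc k) (e + 1) \<le> Suc (naf_weight k ((e + 1) div 2))" for e
    proof -
      obtain m where m: "e = 2 * m \<or> e = 2 * m + 1" by (meson oddE evenE)
      have "(2 * m + 1 + 1) div 2 = m + 1" "2 * m + 1 + 1 = 2 * (m + 1)" "(2 * m + 1) div 2 = m"
        by simp_all
      then show "naf_weight (Suc k) e \<le> Suc (naf_weight k ((e + 1) div 2))"
        "naf_weight (Suc k) (e + 1) \<le> Suc (naf_weight k ((e + 1) div 2))"
        using m IHS[of "2 * m" 0] IHS[of "2 * m + 1" 0] dbl[of m] dbl[of "m + 1"]
        by (auto simp: ac_simps)
    qed
    \<comment> \<open>For \<open>k > 0\<close> the odd number \<open>2 * e + 1\<close> weighs one
      more than the even one of \<open>e\<close> and \<open>e + 1\<close>, and the other of these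
      two weighs at most one more than the even one.\<close>
    have near': "naf_weight k e \<le> naf_weight (Suc k) (2 * e + 1)"
       "naf_weight k (e + 1) \<le> naf_weight (Suc k) (2 * e + 1)" for e
    proof -
      have "naf_weight k e \<le> naf_weight (Suc k) (2 * e + 1) \<and>
        naf_weight k (e + 1) \<le> naf_weight (Suc k) (2 * e + 1)"
      proof (cases k)
        case (Suc l)
        obtain m where m: "e = 2 * m \<or> e = 2 * m + 1" by (meson oddE evenE)
        have "(2 * (2 * m) + 1 + 1) div 4 = m" "(2 * (2 * m + 1) + 1 + 1) div 4 = m + 1"
          by simp_all
        then show ?thesis
          using m IH[of "2 * m" 0] IH[of "2 * m + 1" 0] Suc
            naf_weight_double[of l m] naf_weight_double[of l "m + 1"]
          by (auto simp: algebra_simps)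
      qed simp
      then show "naf_weight k e \<le> naf_weight (Suc k) (2 * e + 1)"
       "naf_weight k (e + 1) \<le> naf_weight (Suc k) (2 * e + 1)" by auto
    qed
    consider (ev) "even d" "i > 0" | (odd2) "odd d" "i \<ge> 2" | (odd1) "odd d" "i = 1"
      | (ev0) "even d" "i = 0" | (odd0) "odd d" "i = 0" by linarith
    then show ?thesis
    proof cases
      case ev
      then obtain e j where e: "d = 2 * e" "i = Suc j" by (metis evenE gr0_implies_Suc)
      have "d + 2 ^ i = 2 * (e + 2 ^ j)" by (simp add: e)
      then show ?thesis
        unfolding 3 using IHS[of e j] by (simp only: naf_weight_double e(1))
    next
      case odd2
      then obtain j where j: "i = Suc (Suc j)" using that[of "i - 2"] by simp
      have "(d + 2 ^ i + 1) div 4 = (d + 1) div 4 + 2 ^ j"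
        unfolding j by (simp add: algebra_simps)
      then show ?thesis using IH[of "(d + 1) div 4" j] odd2 3 by simp
    next
      case odd1
      have "(d + 2 + 1) div 4 = (d + 1) div 4 \<or> (d + 2 + 1) div 4 = (d + 1) div 4 + 1" by presburger
      then show ?thesis using IH[of "(d + 1) div 4" 0] odd1 3 by auto
    next
      case ev0
      then obtain e where e: "d = 2 * e" by blast
      obtain m where m: "e = 2 * m \<or> e = 2 * m + 1" by (meson oddE evenE)
      \<comment> \<open>With \<open>d = 2 * e\<close>, the two weights to compare are
        \<open>naf_weight (Suc k) e\<close> and one plus the weight of \<open>(e + 1) div 2\<close>
        at length \<open>k\<close>.\<close>
      have "naf_weight h (d + 1) = Suc (naf_weight k ((e + 1) div 2))"
      proof -
        have "(d + 1 + 1) div 4 = (e + 1) div 2" unfolding e by presburger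
        then show ?thesis using 3 ev0 by simp
      qed
      moreover have "naf_weight h d = naf_weight (Suc k) e"
        using e 3 naf_weight_double by simp
      moreover have "naf_weight k ((e + 1) div 2) \<le> naf_weight (Suc k) e"
        using m near'[of m] dbl[of m] by (auto simp: ac_simps)
      ultimately show ?thesis using near(1)[of e] ev0 by simp
    next
      case odd0
      then obtain e where e: "d = 2 * e + 1" by (meson oddE)
      obtain m where m: "e = 2 * m \<or> e = 2 * m + 1" by (meson oddE evenE)
      have "naf_weight h d = Suc (naf_weight k ((e + 1) div 2))"
      proof -
        have "(d + 1) div 4 = (e + 1) div 2" unfolding e by presburger
        then show ?thesis using 3 odd0 by simp
      qed
      moreover have "naf_weight h (d + 1) = naf_weight (Suc k) (e + 1)"
        using e 3 naf_weight_double[of "Suc k" "e + 1"] by (simp add: algebra_simps)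
      moreover have "naf_weight k ((e + 1) div 2) \<le> naf_weight (Suc k) (e + 1)"
        using m near'[of m] dbl[of "m + 1"] by (auto simp: algebra_simps)
      ultimately show ?thesis using near(2)[of e] odd0 by simp
    qed
  qed simp_all
qed

section \<open>Total weight of all residues\<close>

lemma sum_int_even_odd:
  fixes f :: "int \<Rightarrow> 'a::comm_monoid_add"
  shows "(\<Sum>d\<in>{0..<2 * int n}. f d) = (\<Sum>d\<in>{0..<int n}. f (2 * d) + f (2 * d + 1))"
proof (induction n)
  case (Suc n)
  have "{0..<2 * int (Suc n)} = insert (2 * int n + 1) (insert (2 * int n) {0..<2 * int n})"
    "{0..<int (Suc n)} = insert (int n) {0..<int n}" by auto
  with Suc show ?case by (simp add: algebra_simps)
qed simp

lemma sum_naf_weight_shift: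
  "(\<Sum>y\<in>{0..<2 ^ h}. naf_weight h (y + c)) = (\<Sum>d\<in>{0..<2 ^ h}. naf_weight h d)"
proof -
  have inj: "inj_on (\<lambda>y. (y + c) mod 2 ^ h) {0..<2 ^ h :: int}"
    by (rule inj_onI) (metis atLeastLessThan_iff cong_add_rcancel cong_def mod_pos_pos_trivial)
  have "(\<lambda>y. (y + c) mod 2 ^ h) ` {0..<2 ^ h :: int} = {0..<2 ^ h}"
    by (rule endo_inj_surj[OF _ _ inj]) auto
  then have "(\<Sum>d\<in>{0..<2 ^ h}. naf_weight h d) = (\<Sum>y\<in>{0..<2 ^ h}. naf_weight h ((y + c) mod 2 ^ h))"
    using sum.reindex[OF inj, of "naf_weight h"] by simp
  then show ?thesis by (simp add: naf_weight_mod)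
qed

text \<open>Even residues contribute the sum for \<open>Suc h\<close>. The residues
  \<open>4 * d + 1\<close> and \<open>4 * d + 3\<close> weigh one more than \<open>d\<close> and
  \<open>d + 1\<close> respectively, and translation by 1 does not change the sum over all residues
  modulo \<open>2 ^ h\<close>.\<close>

lemma sum_naf_weight_rec:
  "(\<Sum>d\<in>{0..<2 ^ Suc (Suc h)}. naf_weight (Suc (Suc h)) d) =
   (\<Sum>d\<in>{0..<2 ^ Suc h}. naf_weight (Suc h) d) + 2 ^ Suc h + 2 * (\<Sum>d\<in>{0..<2 ^ h}. naf_weight h d)"
proof -
  have odd_part: "naf_weight (Suc (Suc h)) (2 * (2 * d) + 1) = Suc (naf_weight h d)"
    "naf_weight (Suc (Suc h)) (2 * (2 * d + 1) + 1) = Suc (naf_weight h (d + 1))" for d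
  proof -
    have "(2 * (2 * d) + 1 + 1) div 4 = d" "(2 * (2 * d + 1) + 1 + 1) div 4 = d + 1" by simp_all
    then show "naf_weight (Suc (Suc h)) (2 * (2 * d) + 1) = Suc (naf_weight h d)"
      "naf_weight (Suc (Suc h)) (2 * (2 * d + 1) + 1) = Suc (naf_weight h (d + 1))"
      by (simp_all add: add.commute)
  qed
  have "(\<Sum>d\<in>{0..<2 ^ Suc (Suc h)}. naf_weight (Suc (Suc h)) d) =
    (\<Sum>d\<in>{0..<2 ^ Suc h}. naf_weight (Suc (Suc h)) (2 * d) + naf_weight (Suc (Suc h)) (2 * d + 1))"
    using sum_int_even_odd[of "naf_weight (Suc (Suc h))" "2 ^ Suc h"] by simp
  also have "\<dots> = (\<Sum>d\<in>{0..<2 ^ Suc h}. naf_weight (Suc h) d) +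
      (\<Sum>d\<in>{0..<2 ^ Suc h}. naf_weight (Suc (Suc h)) (2 * d + 1))"
    by (simp only: sum.distrib naf_weight_double)
  also have "(\<Sum>d\<in>{0..<2 ^ Suc h}. naf_weight (Suc (Suc h)) (2 * d + 1)) =
      (\<Sum>d\<in>{0..<2 ^ h}. Suc (naf_weight h d) + Suc (naf_weight h (d + 1)))"
    using sum_int_even_odd[of "\<lambda>d. naf_weight (Suc (Suc h)) (2 * d + 1)" "2 ^ h"]
    by (simp only: odd_part) simp
  also have "\<dots> = 2 ^ Suc h + 2 * (\<Sum>d\<in>{0..<2 ^ h}. naf_weight h d)"
    using sum_naf_weight_shift[of h 1] by (simp add: sum.distrib sum_Suc nat_power_eq)
  finally show ?thesis by simp
qed

text \<open>The recurrence has characteristic roots 2 and -1; its inhomogeneous term resonates with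
  the root 2, which accounts for the summand \<open>3 * real h * 2 ^ h\<close>.\<close>

lemma sum_naf_weight:
  "9 * real (\<Sum>d\<in>{0..<2 ^ h}. naf_weight h d) = (3 * real h + 1) * 2 ^ h - (-1) ^ h"
proof (induction h rule: induct_nat_012)
  case 1
  have "{0..<2::int} = {0, 1}" by auto
  then show ?case by simp
next
  case (ge2 n)
  then show ?case unfolding sum_naf_weight_rec
    by (simp add: algebra_simps)
qed simp

section \<open>Edges of vertex lists\<close>

lemma path_edges_singleton [simp]: "path_edges [x] = {}"
  by (simp add: path_edges_def)

lemma path_edges_Cons [simp]: "path_edges (a # b # xs) = insert {a, b} (path_edges (b # xs))"
proof -
  have "(\<exists>i. e = {(a # b # xs) ! i, (b # xs) ! i} \<and> i < Suc (length xs)) \<longleftrightarrow>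
      e = {a, b} \<or> (\<exists>i. e = {(b # xs) ! i, xs ! i} \<and> i < length xs)" for e
  proof -
    have "(\<exists>i. P i) \<longleftrightarrow> P 0 \<or> (\<exists>i. P (Suc i))" for P :: "nat \<Rightarrow> bool"
      by (metis not0_implies_Suc)
    from this[of "\<lambda>i. e = {(a # b # xs) ! i, (b # xs) ! i} \<and> i < Suc (length xs)"]
    show ?thesis by simp
  qed
  then show ?thesis
    unfolding path_edges_def by auto
qed

lemma path_edges_subset: "e \<in> path_edges p \<Longrightarrow> e \<subseteq> set p"
  by (auto simp: path_edges_def)

lemma finite_path_edges: "finite (path_edges p)"
  by (rule finite_subset[of _ "Pow (set p)"]) (auto dest: path_edges_subset)

lemma card_path_edges: "distinct p \<Longrightarrow> card (path_edges p) = length p - 1"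
proof (induction p rule: induct_list012)
  case (3 x y zs)
  then have "{x, y} \<notin> path_edges (y # zs)"
    using path_edges_subset[of "{x, y}" "y # zs"] by auto
  with 3 show ?case by (simp add: finite_path_edges)
qed (simp_all add: path_edges_def)

text \<open>Neighbours that survive the removal of repetitions come from a place where the original
  list really changes. For binary routes these places are the nonzero digits.\<close>

lemma path_edges_map_remdups_adj:
  "path_edges (map f (remdups_adj xs)) \<subseteq>
     {{f (xs ! i), f (xs ! Suc i)} | i. Suc i < length xs \<and> xs ! i \<noteq> xs ! Suc i}"
proof (induction xs rule: remdups_adj.induct)
  case (3 x y xs)
  define steps where "steps zs = {{f (zs ! i), f (zs ! Suc i)} | i.
      Suc i < length zs \<and> zs ! i \<noteq> zs ! Suc i}" for zs
  have shift: "steps (y # xs) \<subseteq> steps (x # y # xs)"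
    unfolding steps_def by (auto intro: exI[of _ "Suc _"])
  have "path_edges (map f (remdups_adj (x # y # xs))) \<subseteq> steps (x # y # xs)"
  proof (cases "x = y")
    case True
    then show ?thesis using 3(1)[OF True] shift by (auto simp: steps_def)
  next
    case False
    obtain zs where zs: "remdups_adj (y # xs) = y # zs"
      by (metis remdups_adj_Cons_alt)
    have "{f x, f y} \<in> steps (x # y # xs)"
      using False by (auto simp: steps_def intro!: exI[of _ 0])
    moreover have "path_edges (map f (remdups_adj (y # xs))) \<subseteq> steps (y # xs)"
      using 3(2)[OF False] by (simp only: steps_def)
    ultimately show ?thesis using shift False by (auto simp: zs)
  qed
  then show ?case by (simp only: steps_def)
qed (simp_all add: path_edges_def)

lemma distinct_remdups_adj: "sorted xs \<Longrightarrow> distinct (remdups_adj xs)"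
  by (induction xs rule: remdups_adj.induct) force+

section \<open>Forwarding index and total load of a routing\<close>

lemma edge_forwarding_index_le:
  "is_routing G R \<Longrightarrow> edge_forwarding_index G \<le> max_edge_load G R"
  unfolding edge_forwarding_index_def by (rule Least_le) blast

text \<open>The least value is meaningful only if the set of values is nonempty, so some routing has
  to be supplied.\<close>

lemma edge_forwarding_index_attained:
  assumes "is_routing G R"
  obtains R' where "is_routing G R'" "max_edge_load G R' = edge_forwarding_index G"
  using LeastI_ex[of "\<lambda>k. \<exists>R. is_routing G R \<and> max_edge_load G R = k"] assms
  unfolding edge_forwarding_index_def by blast

text \<open>Double counting of incidences between edges and routed pairs; as the vertices of a path
  are distinct, it has \<open>length (R x y) - 1\<close> different edges.\<close>

lemma sum_edge_load:
  assumes V: "finite (uverts G)" and E: "finite (uedges G)" and R: "is_routing G R"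
  shows "(\<Sum>e\<in>uedges G. edge_load G R e) =
     (\<Sum>x\<in>uverts G. \<Sum>y\<in>uverts G - {x}. length (R x y) - 1)"
proof -
  define P where "P = (SIGMA x:uverts G. uverts G - {x})"
  have fin: "finite P" using V by (auto simp: P_def)
  have "(\<Sum>e\<in>uedges G. edge_load G R e) =
      (\<Sum>e\<in>uedges G. \<Sum>(x, y)\<in>P. if e \<in> path_edges (R x y) then 1 else 0)"
  proof (rule sum.cong)
    fix e
    have "{(x, y). x \<in> uverts G \<and> y \<in> uverts G \<and> x \<noteq> y \<and> e \<in> path_edges (R x y)} =
        P \<inter> {q. e \<in> path_edges (R (fst q) (snd q))}"
      by (auto simp: P_def)
    then show "edge_load G R e = (\<Sum>(x, y)\<in>P. if e \<in> path_edges (R x y) then 1 else 0)"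
      using fin by (simp add: edge_load_def sum.If_cases case_prod_beta)
  qed simp
  also have "\<dots> = (\<Sum>(x, y)\<in>P. \<Sum>e\<in>uedges G. if e \<in> path_edges (R x y) then 1 else 0)"
    by (subst sum.swap) (simp add: case_prod_beta)
  also have "\<dots> = (\<Sum>(x, y)\<in>P. length (R x y) - 1)"
  proof (intro sum.cong refl, clarify)
    fix x y assume "(x, y) \<in> P"
    then have p: "is_path G x (R x y) y" using R by (auto simp: P_def is_routing_def)
    then have "uedges G \<inter> path_edges (R x y) = path_edges (R x y)"
      by (auto simp: is_path_def)
    then show "(\<Sum>e\<in>uedges G. if e \<in> path_edges (R x y) then 1 else 0) = length (R x y) - 1"
      using p E by (simp add: sum.If_cases card_path_edges is_path_def)
  qed
  also have "\<dots> = (\<Sum>x\<in>uverts G. \<Sum>y\<in>uverts G - {x}. length (R x y) - 1)"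
    unfolding P_def using V by (subst sum.Sigma) auto
  finally show ?thesis .
qed

lemma sum_edge_load_le:
  assumes "finite (uedges G)"
  shows "(\<Sum>e\<in>uedges G. edge_load G R e) \<le> card (uedges G) * max_edge_load G R"
  using sum_bounded_above[of "uedges G" "edge_load G R" "max_edge_load G R"] assms
  by (simp add: max_edge_load_def)

section \<open>Lower bound for the multiplicative circulant graph\<close>

lemma uverts_MC2: "uverts (MC 2 h) = {0..<2 ^ h}"
  by (simp add: MC_def Let_def)

lemma doubleton_in_uedges_MC2_iff:
  "{x, y} \<in> uedges (MC 2 h) \<longleftrightarrow> x \<in> {0..<2 ^ h} \<and> y \<in> {0..<2 ^ h} \<and> x \<noteq> y \<and>
    (\<exists>i<h. [x - y = 2 ^ i] (mod 2 ^ h) \<or> [x - y = - (2 ^ i)] (mod 2 ^ h))"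
proof -
  have sym: "[b - a = c] (mod 2 ^ h) \<longleftrightarrow> [a - b = - c] (mod 2 ^ h)" for a b c :: int
    by (metis cong_minus_minus_iff minus_diff_eq)
  show ?thesis
    unfolding MC_def Let_def
    by (auto simp: doubleton_eq_iff sym[of y x])
qed

lemma finite_uedges_MC2: "finite (uedges (MC 2 h))"
  by (rule finite_subset[of _ "Pow {0..<2 ^ h}"]) (auto simp: MC_def Let_def)

text \<open>For either sign of the generator, one of \<open>z - x\<close> and \<open>z - y\<close>
  is congruent to the other plus \<open>2 ^ i\<close>, so the two-sided estimate
  \<open>naf_weight_step\<close> covers both.\<close>

lemma naf_weight_edge:
  assumes "{x, y} \<in> uedges (MC 2 h)"
  shows "naf_weight h (z - x) \<le> Suc (naf_weight h (z - y))"
proof -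
  obtain i where "[x - y = 2 ^ i] (mod 2 ^ h) \<or> [x - y = - (2 ^ i)] (mod 2 ^ h)"
    using assms by (auto simp: doubleton_in_uedges_MC2_iff)
  then have "[z - y = z - x + 2 ^ i] (mod 2 ^ h) \<or> [z - x = z - y + 2 ^ i] (mod 2 ^ h)"
    by (auto simp: cong_iff_dvd_diff dvd_diff_commute algebra_simps)
  then have "naf_weight h (z - y) = naf_weight h (z - x + 2 ^ i) \<or>
      naf_weight h (z - x) = naf_weight h (z - y + 2 ^ i)"
    using naf_weight_cong by blast
  then show ?thesis
    using naf_weight_step[of h "z - x" i] naf_weight_step[of h "z - y" i] by auto
qed

text \<open>Each edge lowers the weight of the remaining difference by at most one, and at the
  endpoint this weight is zero.\<close>

lemma naf_weight_le_walk:
  assumes "p \<noteq> []" "path_edges p \<subseteq> uedges (MC 2 h)"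
  shows "naf_weight h (last p - hd p) \<le> length p - 1"
  using assms
proof (induction p rule: induct_list012)
  case (3 x y zs)
  then have "naf_weight h (last (y # zs) - y) \<le> length (y # zs) - 1" by simp
  moreover have "naf_weight h (last (y # zs) - x) \<le> Suc (naf_weight h (last (y # zs) - y))"
    using 3 by (intro naf_weight_edge) simp
  ultimately show ?case by simp
qed simp_all

text \<open>Each \<open>i < h - 1\<close> yields at most one edge \<open>arc i x\<close> per vertex
  \<open>x\<close>. For \<open>i = h - 1\<close> the step is its own negative modulo
  \<open>2 ^ h\<close>, so half of the vertices already give all edges.\<close>

lemma card_uedges_MC2:
  assumes "h > 0"
  shows "card (uedges (MC 2 h)) \<le> (2 * h - 1) * 2 ^ (h - 1)"
proof -
  obtain k where k: "h = Suc k" using assms gr0_implies_Suc by blast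
  define arc where "arc i x = {x, (x + 2 ^ i) mod 2 ^ h}" for i :: nat and x :: int
  have half: "arc k x \<in> arc k ` {0..<2 ^ k}" if x: "x \<in> {0..<2 ^ h}" for x
  proof (cases "x < 2 ^ k")
    case False
    have "(x + 2 ^ k) mod 2 ^ h = (x - 2 ^ k + 1 * 2 ^ h) mod 2 ^ h"
      by (simp add: k add.commute)
    also have "\<dots> = x - 2 ^ k" using False x unfolding mod_mult_self1 by (simp add: k)
    finally have "arc k x = arc k (x - 2 ^ k)"
      using x by (auto simp: arc_def)
    then show ?thesis using False x by (auto simp: k)
  qed (use x in auto)
  have "uedges (MC 2 h) \<subseteq> (\<Union>i<k. arc i ` {0..<2 ^ h}) \<union> arc k ` {0..<2 ^ k}"
  proof
    fix e assume "e \<in> uedges (MC 2 h)"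
    then obtain x y i where e: "e = {x, y}" and xy: "x \<in> {0..<2 ^ h}" "y \<in> {0..<2 ^ h}" and "i < h"
      and "[x - y = 2 ^ i] (mod 2 ^ h) \<or> [x - y = - (2 ^ i)] (mod 2 ^ h)"
      by (auto simp: MC_def Let_def)
    then have "[x = y + 2 ^ i] (mod 2 ^ h) \<or> [y = x + 2 ^ i] (mod 2 ^ h)"
      by (auto simp: cong_iff_dvd_diff dvd_diff_commute algebra_simps)
    then have "e = arc i y \<or> e = arc i x"
      using xy e by (auto simp: arc_def cong_def)
    then have "e \<in> arc i ` {0..<2 ^ h}" "i = k \<Longrightarrow> e \<in> arc k ` {0..<2 ^ k}"
      using xy half by blast+
    then show "e \<in> (\<Union>i<k. arc i ` {0..<2 ^ h}) \<union> arc k ` {0..<2 ^ k}"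
      using \<open>i < h\<close> k less_antisym by blast
  qed
  then have "card (uedges (MC 2 h)) \<le> card ((\<Union>i<k. arc i ` {0..<2 ^ h}) \<union> arc k ` {0..<2 ^ k})"
    by (intro card_mono) auto
  also have "\<dots> \<le> (\<Sum>i<k. card (arc i ` {0..<2 ^ h})) + card (arc k ` {0..<2 ^ k})"
    by (intro card_Un_le[THEN order_trans] add_mono card_UN_le) auto
  also have "\<dots> \<le> (\<Sum>i<k. 2 ^ h) + 2 ^ k"
    using card_image_le[of "{0..<2 ^ h :: int}"] card_image_le[of "{0..<2 ^ k :: int}"]
    by (intro add_mono sum_mono) (simp_all add: nat_power_eq)
  also have "\<dots> = (2 * h - 1) * 2 ^ (h - 1)" by (simp add: k)
  finally show ?thesis .
qed

lemma max_edge_load_MC2_ge: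
  assumes h: "h > 0" and R: "is_routing (MC 2 h) R"
  shows "2 * (\<Sum>d\<in>{0..<2 ^ h}. naf_weight h d) \<le> (2 * h - 1) * max_edge_load (MC 2 h) R"
proof -
  let ?S = "\<Sum>d\<in>{0..<2 ^ h}. naf_weight h d"
  \<comment> \<open>For fixed \<open>x\<close> the differences \<open>y - x\<close> run through all
    residues.\<close>
  have "2 ^ h * ?S = (\<Sum>x\<in>{0..<2 ^ h::int}. \<Sum>y\<in>{0..<2 ^ h}. naf_weight h (y - x))"
    using sum_naf_weight_shift[of h "- _"] by simp
  \<comment> \<open>The diagonal term has weight zero, and a routing serves only distinct
    pairs.\<close>
  also have "\<dots> = (\<Sum>x\<in>{0..<2 ^ h::int}. \<Sum>y\<in>{0..<2 ^ h} - {x}. naf_weight h (y - x))"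
  proof (rule sum.cong[OF refl])
    fix x :: int assume "x \<in> {0..<2 ^ h}"
    then show "(\<Sum>y\<in>{0..<2 ^ h}. naf_weight h (y - x)) =
        (\<Sum>y\<in>{0..<2 ^ h} - {x}. naf_weight h (y - x))"
      by (subst sum.remove[of _ x]) simp_all
  qed
  also have "\<dots> \<le> (\<Sum>x\<in>{0..<2 ^ h}. \<Sum>y\<in>{0..<2 ^ h} - {x}. length (R x y) - 1)"
  proof (intro sum_mono)
    fix x y :: int assume "x \<in> {0..<2 ^ h}" "y \<in> {0..<2 ^ h} - {x}"
    then have "is_path (MC 2 h) x (R x y) y"
      using R by (auto simp: is_routing_def uverts_MC2)
    then show "naf_weight h (y - x) \<le> length (R x y) - 1"
      using naf_weight_le_walk[of "R x y" h] by (auto simp: is_path_def)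
  qed
  also have "\<dots> = (\<Sum>e\<in>uedges (MC 2 h). edge_load (MC 2 h) R e)"
    using sum_edge_load[of "MC 2 h" R] R by (simp add: uverts_MC2 finite_uedges_MC2)
  also have "\<dots> \<le> card (uedges (MC 2 h)) * max_edge_load (MC 2 h) R"
    by (rule sum_edge_load_le[OF finite_uedges_MC2])
  also have "\<dots> \<le> (2 * h - 1) * 2 ^ (h - 1) * max_edge_load (MC 2 h) R"
    by (intro mult_right_mono card_uedges_MC2[OF h]) simp
  finally have "2 ^ h * ?S \<le> (2 * h - 1) * 2 ^ (h - 1) * max_edge_load (MC 2 h) R" .
  moreover have "(2::nat) ^ h = 2 ^ (h - 1) * 2"
    using h by (cases h) simp_all
  ultimately have "2 ^ (h - 1) * (2 * ?S) \<le> 2 ^ (h - 1) * ((2 * h - 1) * max_edge_load (MC 2 h) R)"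
    by (simp only: mult_ac)
  then show ?thesis by (rule mult_left_le_imp_le) simp
qed

section \<open>Routing along binary expansions\<close>

text \<open>The residues \<open>(y - x) mod 2 ^ k\<close> for \<open>k = 0, ..., h\<close> are the
  partial sums of the binary expansion of \<open>(y - x) mod 2 ^ h\<close>. A zero digit repeats a
  partial sum, and the repetition is removed.\<close>

definition binary_route :: "nat \<Rightarrow> int \<Rightarrow> int \<Rightarrow> int list" where
  "binary_route h x y = map (\<lambda>e. (x + e) mod 2 ^ h)
     (remdups_adj (map (\<lambda>k. (y - x) mod 2 ^ k) [0..<Suc h]))"

text \<open>The parity of \<open>d div 2 ^ k\<close> is binary digit \<open>k\<close> of
  \<open>d\<close>; digits are expressed in this way below.\<close>

lemma mod_power2_Suc:
  "(d::int) mod 2 ^ Suc k = d mod 2 ^ k + (if odd (d div 2 ^ k) then 2 ^ k else 0)"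
  using mod_mult2_eq'[of d "2 ^ k" 2] by (auto simp: mult.commute odd_iff_mod_2_eq_one)

lemma binary_route_edges:
  "e \<in> path_edges (binary_route h x y) \<Longrightarrow>
    \<exists>k<h. odd ((y - x) div 2 ^ k) \<and>
      e = {(x + (y - x) mod 2 ^ k) mod 2 ^ h, (x + (y - x) mod 2 ^ k + 2 ^ k) mod 2 ^ h}"
proof -
  let ?f = "\<lambda>e. (x + e) mod 2 ^ h" and ?es = "map (\<lambda>k. (y - x) mod 2 ^ k) [0..<Suc h]"
  assume "e \<in> path_edges (binary_route h x y)"
  then have "e \<in> path_edges (map ?f (remdups_adj ?es))" by (simp only: binary_route_def)
  with path_edges_map_remdups_adj[of ?f ?es]
  obtain k where k: "Suc k < length ?es" "?es ! k \<noteq> ?es ! Suc k"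
    and e: "e = {?f (?es ! k), ?f (?es ! Suc k)}"
    by blast
  have nth: "?es ! k = (y - x) mod 2 ^ k" "?es ! Suc k = (y - x) mod 2 ^ Suc k"
    using k(1) by (simp_all add: nth_map_upt del: upt_Suc power_Suc)
  show ?thesis
    using k e unfolding nth
    by (intro exI[of _ k])
      (auto simp: mod_power2_Suc add.assoc simp del: power_Suc split: if_splits)
qed

text \<open>The partial sums are nondecreasing and lie below \<open>2 ^ h\<close>, where translation
  by \<open>x\<close> modulo \<open>2 ^ h\<close> is injective. So the visited vertices are distinct
  once repetitions are removed.\<close>

lemma is_routing_binary_route: "is_routing (MC 2 h) (binary_route h)"
  unfolding is_routing_def uverts_MC2
proof (intro ballI impI)
  fix x y :: int assume x: "x \<in> {0..<2 ^ h}" and y: "y \<in> {0..<2 ^ h}" and "x \<noteq> y"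
  let ?es = "map (\<lambda>k. (y - x) mod 2 ^ k) [0..<Suc h]"
  have range: "set ?es \<subseteq> {0..<2 ^ h}"
  proof -
    have "(y - x) mod 2 ^ k < 2 ^ h" if "k < Suc h" for k
    proof -
      have "(y - x) mod 2 ^ k < 2 ^ k" by simp
      also have "(2::int) ^ k \<le> 2 ^ h" using that by (intro power_increasing) auto
      finally show ?thesis .
    qed
    then show ?thesis by (auto simp del: upt_Suc)
  qed
  have inj: "inj_on (\<lambda>e. (x + e) mod 2 ^ h) {0..<2 ^ h}"
    by (rule inj_onI) (metis atLeastLessThan_iff cong_add_lcancel cong_def mod_pos_pos_trivial)
  have "mono (\<lambda>k. (y - x) mod 2 ^ k)"
    by (rule incseq_SucI) (simp add: mod_power2_Suc del: power_Suc)
  then have "sorted ?es"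
    by (simp add: sorted_map_mono mono_imp_mono_on del: upt_Suc)
  then have dist: "distinct (binary_route h x y)"
    unfolding binary_route_def using range inj
    by (auto simp: distinct_map distinct_remdups_adj simp del: upt_Suc intro: inj_on_subset)
  have "hd (binary_route h x y) = x"
    unfolding binary_route_def using x by (simp add: hd_map upt_conv_Cons del: upt_Suc)
  moreover have "last (binary_route h x y) = y"
    unfolding binary_route_def using y by (simp add: last_map mod_simps)
  moreover have "path_edges (binary_route h x y) \<subseteq> uedges (MC 2 h)"
  proof
    fix e assume "e \<in> path_edges (binary_route h x y)"
    then obtain k where "k < h" and
      e: "e = {(x + (y - x) mod 2 ^ k) mod 2 ^ h, (x + (y - x) mod 2 ^ k + 2 ^ k) mod 2 ^ h}"
      using binary_route_edges by blast
    define u where "u = x + (y - x) mod 2 ^ k"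
    have "[u mod 2 ^ h - (u + 2 ^ k) mod 2 ^ h = - (2 ^ k)] (mod 2 ^ h)"
      by (simp add: cong_def mod_simps)
    \<comment> \<open>Equality would make \<open>2 ^ h\<close> divide \<open>2 ^ k\<close>, which is
      impossible for \<open>k < h\<close>.\<close>
    moreover from this have "u mod 2 ^ h \<noteq> (u + 2 ^ k) mod 2 ^ h"
      using \<open>k < h\<close> by (auto simp: cong_iff_dvd_diff dest!: zdvd_imp_le)
    ultimately show "e \<in> uedges (MC 2 h)"
      unfolding e u_def[symmetric] doubleton_in_uedges_MC2_iff using \<open>k < h\<close> by auto
  qed
  ultimately show "is_path (MC 2 h) x (binary_route h x y) y"
    using dist unfolding is_path_def uverts_MC2
    by (auto simp: binary_route_def simp del: upt_Suc)
qed

text \<open>Subtracting \<open>2 ^ k\<close> clears digit \<open>k\<close>, which injects the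
  residues with digit one into those with digit zero.\<close>

lemma card_odd_div_power2:
  assumes "k < h"
  shows "2 * card {d \<in> {0..<2 ^ h :: int}. odd (d div 2 ^ k)} \<le> 2 ^ h"
proof -
  let ?D = "{d \<in> {0..<2 ^ h :: int}. odd (d div 2 ^ k)}"
  let ?D' = "{d \<in> {0..<2 ^ h :: int}. even (d div 2 ^ k)}"
  have "card ?D \<le> card ?D'"
  proof (rule card_inj_on_le[of "\<lambda>d. d - 2 ^ k"])
    show "(\<lambda>d. d - 2 ^ k) ` ?D \<subseteq> ?D'"
    proof (clarsimp, intro conjI)
      fix d :: int assume d: "0 \<le> d" "d < 2 ^ h" "odd (d div 2 ^ k)"
      show le: "2 ^ k \<le> d"
        using d by (metis div_pos_pos_trivial even_zero not_le)
      show "d - 2 ^ k < 2 ^ h" using d(2) by (smt (verit) zero_less_power)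
      have "(d - 2 ^ k) div 2 ^ k = d div 2 ^ k - 1"
        using div_mult_self1[of "2 ^ k" d "- 1"] by simp
      then show "even ((d - 2 ^ k) div 2 ^ k)" using d(3) by simp
    qed
  next
    show "finite ?D'" by (rule finite_subset[of _ "{0..<2 ^ h}"]) auto
  qed (auto simp: inj_on_def)
  moreover have "card ?D + card ?D' = card {0..<2 ^ h :: int}"
  proof (subst card_Un_disjoint[symmetric])
    show "finite ?D" "finite ?D'" by (rule finite_subset[of _ "{0..<2 ^ h}"]; auto)+
    show "card (?D \<union> ?D') = card {0..<2 ^ h :: int}" by (rule arg_cong[where f = card]) auto
  qed auto
  moreover have "card {0..<2 ^ h :: int} = 2 ^ h" by (simp add: nat_power_eq)
  ultimately show ?thesis by linarith
qed

text \<open>The set contains the pairs whose route crosses from \<open>u\<close> to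
  \<open>v\<close>. The difference \<open>v - u\<close> fixes the digit position \<open>k\<close>;
  then \<open>d = (y - x) mod 2 ^ h\<close> fixes \<open>x\<close> by walking back from
  \<open>u\<close> through the lower digits of \<open>d\<close>, and so fixes \<open>y\<close>. Only
  residues \<open>d\<close> with digit \<open>k\<close> equal to one occur, at most half of
  all.\<close>

lemma card_binary_route_arc:
  fixes u v :: int
  shows "2 * card {(x, y). x \<in> {0..<2 ^ h} \<and> y \<in> {0..<2 ^ h} \<and>
     (\<exists>k<h. odd ((y - x) div 2 ^ k) \<and> u = (x + (y - x) mod 2 ^ k) mod 2 ^ h \<and>
        v = (x + (y - x) mod 2 ^ k + 2 ^ k) mod 2 ^ h)} \<le> 2 ^ h" (is "2 * card ?A \<le> _")
proof (cases "\<exists>k<h. [v - u = 2 ^ k] (mod 2 ^ h)")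
  case True
  then obtain k where k: "k < h" "[v - u = 2 ^ k] (mod 2 ^ h)" by blast
  let ?D = "{d \<in> {0..<2 ^ h :: int}. odd (d div 2 ^ k)}"
  define g where "g d = ((u - d mod 2 ^ k) mod 2 ^ h, ((u - d mod 2 ^ k) mod 2 ^ h + d) mod 2 ^ h)" for d
  have "?A \<subseteq> g ` ?D"
  proof clarify
    fix x y :: int and j
    assume x: "x \<in> {0..<2 ^ h}" and y: "y \<in> {0..<2 ^ h}"
      and j: "j < h" "odd ((y - x) div 2 ^ j)" and u: "u = (x + (y - x) mod 2 ^ j) mod 2 ^ h"
      and v: "v = (x + (y - x) mod 2 ^ j + 2 ^ j) mod 2 ^ h"
    have "[v - u = 2 ^ j] (mod 2 ^ h)" unfolding u v by (simp add: cong_def mod_simps)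
    with k have "[2 ^ j = (2::int) ^ k] (mod 2 ^ h)" by (metis cong_sym cong_trans)
    \<comment> \<open>Both powers are smaller than the modulus, so congruence is equality.\<close>
    then have "(2::int) ^ j = 2 ^ k" using j k by (simp add: cong_def)
    then have jk: "j = k" by simp
    define d where "d = (y - x) mod 2 ^ h"
    have dk: "d mod 2 ^ k = (y - x) mod 2 ^ k"
      unfolding d_def using k by (simp add: mod_mod_cancel le_imp_power_dvd)
    \<comment> \<open>Agreement modulo \<open>2 ^ k\<close> and modulo \<open>2 ^ Suc k\<close>
      shows that \<open>d\<close> and \<open>y - x\<close> share digit \<open>k\<close>.\<close>
    have "d mod 2 ^ Suc k = (y - x) mod 2 ^ Suc k"
      unfolding d_def using k by (intro mod_mod_cancel le_imp_power_dvd) simp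
    then have "odd (d div 2 ^ k)"
      using j(2) dk unfolding jk mod_power2_Suc by (auto split: if_splits)
    moreover have "d \<in> {0..<2 ^ h}" by (simp add: d_def)
    moreover have "(u - d mod 2 ^ k) mod 2 ^ h = x"
      using x unfolding dk u jk by (simp add: mod_simps)
    then have "g d = (x, y)"
      using y unfolding g_def by (simp add: d_def mod_simps)
    ultimately show "(x, y) \<in> g ` ?D" by (metis (mono_tags, lifting) image_eqI mem_Collect_eq)
  qed
  then have "card ?A \<le> card ?D"
    by (rule surj_card_le[rotated]) (rule finite_subset[of _ "{0..<2 ^ h}"], auto)
  with card_odd_div_power2[OF k(1)] show ?thesis by linarith
next
  case False
  have "?A = {}"
  proof (rule ccontr)
    assume "?A \<noteq> {}"
    then obtain x y j where j: "j < h" and u: "u = (x + (y - x) mod 2 ^ j) mod 2 ^ h"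
      and v: "v = (x + (y - x) mod 2 ^ j + 2 ^ j) mod 2 ^ h" by blast
    have "[v - u = 2 ^ j] (mod 2 ^ h)" unfolding u v by (simp add: cong_def mod_simps)
    with False j show False by blast
  qed
  then show ?thesis by (metis card.empty mult_0_right zero_le)
qed

section \<open>Upper bound for the multiplicative circulant graph\<close>

lemma uedges_MC2_nonempty: "h > 0 \<Longrightarrow> uedges (MC 2 h) \<noteq> {}"
proof -
  assume "h > 0"
  then have "{1, 0} \<in> uedges (MC 2 h)"
    unfolding doubleton_in_uedges_MC2_iff by (auto intro!: exI[of _ 0])
  then show ?thesis by blast
qed

lemma max_edge_load_MC2_le:
  assumes "h > 0" and "\<And>u v. {u, v} \<in> uedges (MC 2 h) \<Longrightarrow> edge_load (MC 2 h) R {u, v} \<le> n"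
  shows "max_edge_load (MC 2 h) R \<le> n"
proof -
  have "edge_load (MC 2 h) R e \<le> n" if "e \<in> uedges (MC 2 h)" for e
  proof -
    obtain u v where "e = {u, v}" using \<open>e \<in> _\<close> by (auto simp: MC_def Let_def)
    then show ?thesis using assms(2) that by blast
  qed
  then show ?thesis
    unfolding max_edge_load_def
    using uedges_MC2_nonempty[OF assms(1)] finite_uedges_MC2 by simp
qed

lemma edge_forwarding_index_MC2_le:
  assumes "h > 0"
  shows "edge_forwarding_index (MC 2 h) \<le> 2 ^ h"
proof -
  have "edge_load (MC 2 h) (binary_route h) {u, v} \<le> 2 ^ h" for u v
  proof -
    \<comment> \<open>\<open>A u v\<close> and \<open>A v u\<close> separate the two orientations in
      which a route can use the edge.\<close>
    define A where "A u v = {(x, y). x \<in> {0..<2 ^ h} \<and> y \<in> {0..<2 ^ h} \<and>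
      (\<exists>k<h. odd ((y - x) div 2 ^ k) \<and> u = (x + (y - x) mod 2 ^ k) mod 2 ^ h \<and>
        v = (x + (y - x) mod 2 ^ k + 2 ^ k) mod 2 ^ h)}" for u v :: int
    have fin: "finite (A u v)" for u v
      by (rule finite_subset[of _ "{0..<2 ^ h} \<times> {0..<2 ^ h}"]) (auto simp: A_def)
    have "{(x, y). x \<in> {0..<2 ^ h} \<and> y \<in> {0..<2 ^ h} \<and> x \<noteq> y \<and>
          {u, v} \<in> path_edges (binary_route h x y)}
        \<subseteq> A u v \<union> A v u"
      by (auto simp: A_def doubleton_eq_iff dest!: binary_route_edges)
    then have "edge_load (MC 2 h) (binary_route h) {u, v} \<le> card (A u v \<union> A v u)"
      unfolding edge_load_def uverts_MC2 by (intro card_mono) (simp_all add: fin)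
    also have "\<dots> \<le> card (A u v) + card (A v u)" by (rule card_Un_le)
    also have "\<dots> \<le> 2 ^ h"
      using card_binary_route_arc[of h u v] card_binary_route_arc[of h v u]
      unfolding A_def by linarith
    finally show ?thesis .
  qed
  then show ?thesis
    using edge_forwarding_index_le[OF is_routing_binary_route] max_edge_load_MC2_le[OF assms]
    by (meson order_trans)
qed

text \<open>At \<open>h = 2\<close> the claimed upper bound equals 2, while binary routing only
  guarantees 4.\<close>

lemma edge_forwarding_index_MC2_2: "edge_forwarding_index (MC 2 2) \<le> 2"
proof -
  let ?R = "\<lambda>x y. [x, y]"
  have adj: "{x, y} \<in> uedges (MC 2 2)" if "x \<in> {0..<4}" "y \<in> {0..<4}" "x \<noteq> y" for x y
  proof -
    \<comment> \<open>The nonzero residues modulo 4 are 1, 2 and 3, and 3 is congruent to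
      \<open>- (2 ^ 0)\<close>.\<close>
    have "x \<in> {0, 1, 2, 3}" "y \<in> {0, 1, 2, 3}" using that by auto
    with that(3) have "(x - y) mod 4 \<in> {1, 2, 3}" by auto
    then have "[x - y = 2 ^ 0] (mod 2 ^ 2) \<or> [x - y = 2 ^ 1] (mod 2 ^ 2) \<or>
        [x - y = - (2 ^ 0)] (mod 2 ^ 2)"
      by (auto simp: cong_def)
    moreover have "(0::nat) < 2" "(1::nat) < 2" by simp_all
    ultimately have "\<exists>i<2. [x - y = 2 ^ i] (mod 2 ^ 2) \<or> [x - y = - (2 ^ i)] (mod 2 ^ 2)"
      by blast
    then show ?thesis
      unfolding doubleton_in_uedges_MC2_iff using that by simp
  qed
  then have "is_routing (MC 2 2) ?R"
    by (auto simp: is_routing_def is_path_def uverts_MC2)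
  then have "edge_forwarding_index (MC 2 2) \<le> max_edge_load (MC 2 2) ?R"
    by (rule edge_forwarding_index_le)
  also have "\<dots> \<le> 2"
  proof (rule max_edge_load_MC2_le)
    fix u v
    have "edge_load (MC 2 2) ?R {u, v} \<le> card {(u, v), (v, u)}"
      unfolding edge_load_def by (rule card_mono) (auto simp: doubleton_eq_iff)
    also have "\<dots> \<le> 2" using card_length[of "[(u, v), (v, u)]"] by simp
    finally show "edge_load (MC 2 2) ?R {u, v} \<le> 2" .
  qed simp
  finally show ?thesis .
qed

text \<open>This is what remains of the claimed bound once it is compared with \<open>2 ^ h\<close>
  and \<open>9 * 2 ^ h\<close> cancels. Equality holds at \<open>h = 3\<close>, and the inequality
  fails at \<open>h = 2\<close>.\<close>

lemma upper_bound_slack: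
  assumes "h \<ge> 3"
  shows "36 * real h \<le> (3 * real h + 1) * 2 ^ h - (-1) ^ h + 27"
  using assms
proof (induction h rule: dec_induct)
  case (step n)
  have "(2::real) ^ 3 \<le> 2 ^ n" using step by (intro power_increasing) auto
  moreover have "(2::real) ^ n * 3 \<le> 2 ^ n * real n" using step by (intro mult_left_mono) auto
  moreover have "\<bar>(-1::real) ^ n\<bar> = 1" by (simp add: power_abs)
  ultimately show ?case using step.IH by (auto simp: algebra_simps abs_if split: if_splits)
qed simp

theorem theorem3p31:
  fixes h :: nat
  assumes "h > 0"
  shows "((3 * real h + 1) * 2 ^ (h + 1) - 2 * (-1) ^ h) / (18 * real h - 9)
           \<le> real (edge_forwarding_index (MC 2 h))
       \<and> real (edge_forwarding_index (MC 2 h))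
           \<le> (9 * 2 ^ h + (3 * real h + 1) * 2 ^ h - (-1) ^ h - 36 * real h + 27) / 9"
proof
  let ?\<pi> = "edge_forwarding_index (MC 2 h)"
  obtain R where R: "is_routing (MC 2 h) R" "max_edge_load (MC 2 h) R = ?\<pi>"
    using edge_forwarding_index_attained[OF is_routing_binary_route] .
  have "real (2 * (\<Sum>d\<in>{0..<2 ^ h}. naf_weight h d)) \<le> real ((2 * h - 1) * ?\<pi>)"
    using max_edge_load_MC2_ge[OF assms R(1)] unfolding R(2) by (rule of_nat_mono)
  \<comment> \<open>Multiplication by 9 brings in the closed form of the sum and turns
    \<open>2 * h - 1\<close> into \<open>18 * h - 9\<close>.\<close>
  then have "2 * ((3 * real h + 1) * 2 ^ h - (-1) ^ h) \<le> (18 * real h - 9) * ?\<pi>"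
    using sum_naf_weight[of h] assms by (simp add: of_nat_diff algebra_simps)
  then show "((3 * real h + 1) * 2 ^ (h + 1) - 2 * (-1) ^ h) / (18 * real h - 9) \<le> real ?\<pi>"
    using assms by (simp add: pos_divide_le_eq algebra_simps)
  have le: "real ?\<pi> \<le> 2 ^ h"
    using of_nat_mono[OF edge_forwarding_index_MC2_le[OF assms], where 'a = real] by simp
  consider "h = 1" | "h = 2" | "h \<ge> 3" using assms by linarith
  then show "real ?\<pi> \<le> (9 * 2 ^ h + (3 * real h + 1) * 2 ^ h - (-1) ^ h - 36 * real h + 27) / 9"
  proof cases
    \<comment> \<open>Here the claimed bound evaluates to 2, which is exactly
      \<open>2 ^ h\<close>.\<close>
    case 1
    then show ?thesis using le by simp
  next
    case 2
    then show ?thesis using edge_forwarding_index_MC2_2 by simp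
  next
    case 3
    have "2 ^ h \<le> (9 * 2 ^ h + (3 * real h + 1) * 2 ^ h - (-1) ^ h - 36 * real h + 27) / 9"
      using upper_bound_slack[OF 3] by (simp add: field_simps)
    with le show ?thesis by (rule order_trans)
  qed
qed

end
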